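(* Let $\mathbb F_2$ be the free group of rank $2$. There is an action of $\mathbb F_2$ on a compact metrizable abelian group $X$ by continuous automorphisms such that $\mathbb F_2\curvearrowright X$ has positive naive topological entropy while $X$ has no non-diagonal orbit IE-pairs. Furthermore, (for this action) there is a finite pairwise disjoint closed $\mathcal A\subseteq\mathscr A_2$ with positive independence density such that no element of $\mathcal A$ has positive independence density.
   Context: Let $\Gamma$ be a countably infinite discrete group acting continuously on a compact metrizable space $X$ (here $\Gamma=\mathbb F_2$). Naive topological entropy: for a finite open cover $\mathcal U$ of $X$, $N(\mathcal U)$ is the minimal cardinality of subcovers of $\mathcal U$. For covers $\mathcal U,\mathcal V$, $\mathcal U\vee\mathcal V=\{U\cap V: U\in\mathcal U, V\in\mathcal V\}$. For a nonempty finite $F\subseteq\Gamma$, $\mathcal U^F=\bigvee_{s\in F}s^{-1}\mathcal U$. Set $h^{\rm nv}(\Gamma,\mathcal U)=\inf_F\frac{1}{|F|}\log N(\mathcal U^F)$, with $F$ ranging over nonempty finite subsets of $\Gamma$, and $h^{\rm nv}(\Gamma\curvearrowright X)=\sup_{\mathcal U}h^{\rm nv}(\Gamma,\mathcal U)$, with $\mathcal U$ ranging over finite open covers of $X$. Tuples and independence: $[k]=\{1,\dots,k\}$. For $k\in\mathbb N=\{1,2,\dots\}$, $\mathscr A_k$ is the set of all $k$-tuples of subsets of $X$, and $\mathscr A=\bigcup_{k\ge1}\mathscr A_k$. For $\mathbf A=(A_1,\dots,A_k)\in\mathscr A$, a set $J\subseteq\Gamma$ is an independence set for $\mathbf A$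 if for any nonempty finite $F\subseteq J$ and any map $\omega:F\to[k]$ one has $\bigcap_{s\in F}s^{-1}A_{\omega(s)}\neq\emptyset$. For finite $\mathcal A\subseteq\mathscr A$, the independence density of $\mathcal A$ is the largest $q\ge 0$ such that for every nonempty finite $F\subseteq\Gamma$ there are some $J\subseteq F$ with $|J|\ge q|F|$ and some $\mathbf A\in\mathcal A$ such that $J$ is an independence set for $\mathbf A$. The independence density of a single tuple $\mathbf A$ is that of $\{\mathbf A\}$. A tuple $(A_1,\dots,A_k)$ is pairwise disjoint (resp. closed) if the sets $A_1,\dots,A_k$ are pairwise disjoint (resp. closed in $X$). A family $\mathcal A\subseteq\mathscr A$ is pairwise disjoint (resp. closed) if each $\mathbf A\in\mathcal A$ is. Orbit IE-pair: $(x_1,x_2)\in X^2$ is an orbit IE-pair if for any product neighborhood $U_1\times U_2$ of $(x_1,x_2)$ in $X^2$, the tuple $(U_1,U_2)$ has positive independence density. It is non-diagonal if $x_1\ne x_2$. *)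

theory Defs
  imports "HOL-Analysis.Analysis" "HOL-Algebra.Group_Action"
begin

section \<open>Free groups\<close>

text \<open>
  The free group on a type of generators, realised on reduced words. The letter \<open>(a, True)\<close>
  stands for the generator \<open>a\<close> and \<open>(a, False)\<close> for its inverse.
\<close>

definition inv_letter :: "'g \<times> bool \<Rightarrow> 'g \<times> bool"
  where "inv_letter l = (fst l, \<not> snd l)"

definition reduced :: "('g \<times> bool) list \<Rightarrow> bool"
  where "reduced w \<longleftrightarrow> successively (\<lambda>k l. l \<noteq> inv_letter k) w"

fun cons_letter :: "'g \<times> bool \<Rightarrow> ('g \<times> bool) list \<Rightarrow> ('g \<times> bool) list" where
  "cons_letter l [] = [l]"
| "cons_letter l (k # w) = (if k = inv_letter l then w else l # k # w)"

definition free_group :: "(('g \<times> bool) list) monoid"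
  where "free_group =
    \<lparr>carrier = {w. reduced w}, mult = (\<lambda>u v. foldr cons_letter u v), one = []\<rparr>"

abbreviation F2 :: "((bool \<times> bool) list) monoid"
  where "F2 \<equiv> free_group"

lemma inv_letter_inv_letter [simp]: "inv_letter (inv_letter l) = l"
  by (simp add: inv_letter_def)

lemma inv_letter_neq [simp]: "inv_letter l \<noteq> l" "l \<noteq> inv_letter l"
  by (auto simp: inv_letter_def prod_eq_iff)

lemma reduced_Nil [simp]: "reduced []"
  by (simp add: reduced_def)

lemma reduced_Cons: "reduced (l # w) \<longleftrightarrow> w = [] \<or> hd w \<noteq> inv_letter l \<and> reduced w"
  by (auto simp: reduced_def successively_Cons)

lemma reduced_cons_letter: "reduced w \<Longrightarrow> reduced (cons_letter l w)"
  by (cases w) (auto simp: reduced_Cons)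

lemma cons_letter_reduced: "reduced (l # w) \<Longrightarrow> cons_letter l w = l # w"
  by (cases w) (auto simp: reduced_Cons)

lemma cons_letter_cancel: "reduced w \<Longrightarrow> cons_letter l (cons_letter (inv_letter l) w) = w"
  by (cases w) (auto simp: cons_letter_reduced)

lemma reduced_foldr: "reduced v \<Longrightarrow> reduced (foldr cons_letter u v)"
  by (induction u) (auto simp: reduced_cons_letter)

lemma foldr_cons_letter:
  assumes "reduced u" "reduced v"
  shows "foldr cons_letter (cons_letter l u) v = cons_letter l (foldr cons_letter u v)"
proof (cases u)
  case (Cons k w)
  then show ?thesis
    using cons_letter_cancel[of "foldr cons_letter w v" l] assms by (auto simp: reduced_foldr)
qed simp

lemma foldr_cons_letter_assoc:
  assumes "reduced v" "reduced w"
  shows "foldr cons_letter (foldr cons_letter u v) w = foldr cons_letter u (foldr cons_letter v w)"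
  by (induction u) (simp_all add: foldr_cons_letter reduced_foldr assms)

lemma foldr_cons_letter_Nil: "reduced w \<Longrightarrow> foldr cons_letter w [] = w"
proof (induction w)
  case (Cons l w)
  then have "reduced w" by (auto simp: reduced_Cons)
  with Cons show ?case by (simp add: cons_letter_reduced)
qed simp

lemma foldr_inverse:
  "reduced v \<Longrightarrow> foldr cons_letter (rev (map inv_letter u)) (foldr cons_letter u v) = v"
proof (induction u arbitrary: v)
  case (Cons l u)
  then show ?case
    using cons_letter_cancel[of "foldr cons_letter u v" "inv_letter l"] by (simp add: reduced_foldr)
qed simp

lemma reduced_inverse: "reduced w \<Longrightarrow> reduced (rev (map inv_letter w))"
  unfolding reduced_def successively_rev successively_map
  by (erule successively_mono) (metis inv_letter_inv_letter)

theorem group_free_group: "group free_group"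
proof (rule groupI)
  fix w :: "('g \<times> bool) list"
  assume w: "w \<in> carrier free_group"
  have "foldr cons_letter (rev (map inv_letter w)) w = []"
    using foldr_inverse[of "[]" w] w by (simp add: free_group_def foldr_cons_letter_Nil)
  with w show "\<exists>v\<in>carrier free_group. v \<otimes>\<^bsub>free_group\<^esub> w = \<one>\<^bsub>free_group\<^esub>"
    by (intro bexI[of _ "rev (map inv_letter w)"]) (simp_all add: free_group_def reduced_inverse)
qed (simp_all add: free_group_def reduced_foldr foldr_cons_letter_assoc)

text \<open>The universal property.\<close>

theorem free_group_universal:
  fixes H (structure)
  assumes "group H" and f: "\<And>a. f a \<in> carrier H"
  shows "\<exists>h \<in> hom free_group H. (\<forall>a. h [(a, True)] = f a) \<and>
           (\<forall>h' \<in> hom free_group H. (\<forall>a. h' [(a, True)] = f a) \<longrightarrow>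
              (\<forall>w \<in> carrier free_group. h' w = h w))"
proof -
  interpret H: group H by fact
  define el where "el l = (if snd l then f (fst l) else inv (f (fst l)))" for l
  define ev where "ev w = foldr (\<lambda>l x. el l \<otimes> x) w \<one>" for w
  have el [simp]: "el l \<in> carrier H" for l
    by (simp add: el_def f)
  have el_inv: "el (inv_letter l) = inv (el l)" for l
    by (simp add: el_def inv_letter_def f)
  have ev_simps [simp]: "ev [] = \<one>" "ev (l # w) = el l \<otimes> ev w" for l w
    by (simp_all add: ev_def)
  have ev [simp]: "ev w \<in> carrier H" for w
    by (induction w) auto
  have ev_cons: "ev (cons_letter l w) = el l \<otimes> ev w" for l w
    by (cases w) (auto simp: el_inv H.m_assoc[symmetric])
  have ev_mult: "ev (foldr cons_letter u v) = ev u \<otimes> ev v" for u v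
    by (induction u) (auto simp: ev_cons H.m_assoc)
  have hom: "ev \<in> hom free_group H"
    by (auto simp: hom_def free_group_def ev_mult)
  have "h' w = ev w"
    if h': "h' \<in> hom free_group H" "\<forall>a. h' [(a, True)] = f a" and "w \<in> carrier free_group" for h' w
  proof -
    interpret h': group_hom free_group H h'
      using h'(1) group_free_group \<open>group H\<close> by (simp add: group_hom_def group_hom_axioms_def)
    have letter: "h' [l] = el l" for l
    proof (cases "snd l")
      case True
      then show ?thesis using h'(2) by (cases l) (auto simp: el_def)
    next
      case False
      then obtain a where l: "l = (a, False)" by (cases l) auto
      have "[l] \<otimes>\<^bsub>free_group\<^esub> [(a, True)] = \<one>\<^bsub>free_group\<^esub>"
        by (simp add: free_group_def l inv_letter_def)
      moreover have in_carr: "[k] \<in> carrier free_group" for k :: "_ \<times> bool"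
        by (simp add: free_group_def reduced_Cons)
      ultimately have "h' [l] \<otimes> f a = \<one>"
        using h'.hom_mult[OF in_carr in_carr, of l "(a, True)"] h'(2) by simp
      then have "h' [l] = inv (f a)"
        using H.inv_equality f in_carr by (metis h'.hom_closed)
      then show ?thesis by (simp add: el_def l)
    qed
    from \<open>w \<in> carrier free_group\<close> show ?thesis
    proof (induction w)
      case Nil
      show ?case using h'.hom_one by (simp add: free_group_def)
    next
      case (Cons l w)
      then have w: "w \<in> carrier free_group" and l: "[l] \<in> carrier free_group"
        by (auto simp: free_group_def reduced_Cons)
      have "l # w = [l] \<otimes>\<^bsub>free_group\<^esub> w"
        using Cons.prems by (simp add: free_group_def cons_letter_reduced)
      then show ?case
        using h'.hom_mult[OF l w] Cons.IH[OF w] letter by (metis ev_simps(2))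
    qed
  qed
  moreover have "ev [(a, True)] = f a" for a
    by (simp add: el_def f)
  ultimately show ?thesis
    using hom by blast
qed


section \<open>Actions on compact metrizable spaces and groups\<close>

text \<open>
  By Pontryagin duality every compact metrizable abelian group is isomorphic to a closed subgroup of
  a countable power of the circle, so that seeking such a group with carrier in
  \<open>nat \<Rightarrow> complex\<close> loses no generality.
\<close>

definition compact_metrizable_abelian_group :: "('x, 'm) monoid_scheme \<Rightarrow> 'x topology \<Rightarrow> bool"
  where "compact_metrizable_abelian_group X T \<longleftrightarrow>
    comm_group X \<and> topspace T = carrier X \<and> compact_space T \<and> metrizable_space T \<and>
    continuous_map (prod_topology T T) T (\<lambda>(x, y). x \<otimes>\<^bsub>X\<^esub> y) \<and>
    continuous_map T T (\<lambda>x. inv\<^bsub>X\<^esub> x)"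

definition action_by_continuous_automorphisms ::
    "('g, 'n) monoid_scheme \<Rightarrow> ('x, 'm) monoid_scheme \<Rightarrow> 'x topology \<Rightarrow> ('g \<Rightarrow> 'x \<Rightarrow> 'x) \<Rightarrow> bool"
  where "action_by_continuous_automorphisms G X T \<phi> \<longleftrightarrow>
    group_action G (carrier X) \<phi> \<and>
    (\<forall>s \<in> carrier G. \<phi> s \<in> auto X \<and> continuous_map T T (\<phi> s))"

text \<open>\<open>translate T \<phi> s A\<close> is \<open>s\<^sup>-\<^sup>1 A\<close>, for a subset \<open>A\<close> of the space.\<close>

definition translate :: "'x topology \<Rightarrow> ('g \<Rightarrow> 'x \<Rightarrow> 'x) \<Rightarrow> 'g \<Rightarrow> 'x set \<Rightarrow> 'x set"
  where "translate T \<phi> s A = {x \<in> topspace T. \<phi> s x \<in> A}"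


section \<open>Naive topological entropy\<close>

definition finite_open_cover :: "'x topology \<Rightarrow> 'x set set \<Rightarrow> bool"
  where "finite_open_cover T \<U> \<longleftrightarrow> finite \<U> \<and> (\<forall>U \<in> \<U>. openin T U) \<and> \<Union>\<U> = topspace T"

definition min_subcover :: "'x topology \<Rightarrow> 'x set set \<Rightarrow> nat"
  where "min_subcover T \<U> =
    (LEAST n. \<exists>\<V>. \<V> \<subseteq> \<U> \<and> finite \<V> \<and> \<Union>\<V> = topspace T \<and> card \<V> = n)"

text \<open>The join of the covers \<open>\<U> i\<close> over a nonempty finite index set \<open>I\<close>.\<close>

definition cover_join :: "'i set \<Rightarrow> ('i \<Rightarrow> 'x set set) \<Rightarrow> 'x set set"
  where "cover_join I \<U> = {(\<Inter>i\<in>I. c i) | c. \<forall>i\<in>I. c i \<in> \<U> i}"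

definition cover_power ::
    "'x topology \<Rightarrow> ('g \<Rightarrow> 'x \<Rightarrow> 'x) \<Rightarrow> 'x set set \<Rightarrow> 'g set \<Rightarrow> 'x set set"
  where "cover_power T \<phi> \<U> F = cover_join F (\<lambda>s. translate T \<phi> s ` \<U>)"

definition naive_entropy_cover ::
    "('g, 'n) monoid_scheme \<Rightarrow> 'x topology \<Rightarrow> ('g \<Rightarrow> 'x \<Rightarrow> 'x) \<Rightarrow> 'x set set \<Rightarrow> ereal"
  where "naive_entropy_cover G T \<phi> \<U> =
    (INF F \<in> {F. F \<subseteq> carrier G \<and> finite F \<and> F \<noteq> {}}.
       ereal (ln (real (min_subcover T (cover_power T \<phi> \<U> F))) / real (card F)))"

definition naive_entropy ::
    "('g, 'n) monoid_scheme \<Rightarrow> 'x topology \<Rightarrow> ('g \<Rightarrow> 'x \<Rightarrow> 'x) \<Rightarrow> ereal"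
  where "naive_entropy G T \<phi> = (SUP \<U> \<in> {\<U>. finite_open_cover T \<U>}. naive_entropy_cover G T \<phi> \<U>)"


section \<open>Independence\<close>

text \<open>
  A \<open>k\<close>-tuple of subsets of the space is a list of length \<open>k\<close>; list positions start at \<open>0\<close>, so the
  index set \<open>{1, \<dots>, k}\<close> becomes \<open>{..<k}\<close>.
\<close>

definition set_tuples :: "'x topology \<Rightarrow> nat \<Rightarrow> 'x set list set"
  where "set_tuples T k = {\<A>. length \<A> = k \<and> (\<forall>A \<in> set \<A>. A \<subseteq> topspace T)}"

definition pairwise_disjoint_tuple :: "'x set list \<Rightarrow> bool"
  where "pairwise_disjoint_tuple \<A> \<longleftrightarrow>
    (\<forall>i < length \<A>. \<forall>j < length \<A>. i \<noteq> j \<longrightarrow> \<A> ! i \<inter> \<A> ! j = {})"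

definition closed_tuple :: "'x topology \<Rightarrow> 'x set list \<Rightarrow> bool"
  where "closed_tuple T \<A> \<longleftrightarrow> (\<forall>A \<in> set \<A>. closedin T A)"

definition independence_set ::
    "('g, 'n) monoid_scheme \<Rightarrow> 'x topology \<Rightarrow> ('g \<Rightarrow> 'x \<Rightarrow> 'x) \<Rightarrow> 'x set list \<Rightarrow> 'g set \<Rightarrow> bool"
  where "independence_set G T \<phi> \<A> J \<longleftrightarrow> J \<subseteq> carrier G \<and>
    (\<forall>F \<omega>. F \<subseteq> J \<and> finite F \<and> F \<noteq> {} \<and> \<omega> \<in> F \<rightarrow> {..<length \<A>} \<longrightarrow>
       (\<Inter>s\<in>F. translate T \<phi> s (\<A> ! \<omega> s)) \<noteq> {})"

definition has_independence_density ::
    "('g, 'n) monoid_scheme \<Rightarrow> 'x topology \<Rightarrow> ('g \<Rightarrow> 'x \<Rightarrow> 'x) \<Rightarrow> 'x set list set \<Rightarrow> real \<Rightarrow> bool"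
  where "has_independence_density G T \<phi> \<AA> q \<longleftrightarrow>
    0 \<le> q \<and>
    (\<forall>F. F \<subseteq> carrier G \<and> finite F \<and> F \<noteq> {} \<longrightarrow>
       (\<exists>J \<subseteq> F. q * real (card F) \<le> real (card J) \<and>
          (\<exists>\<A> \<in> \<AA>. independence_set G T \<phi> \<A> J)))"

text \<open>
  For the empty family no \<open>q\<close> qualifies, and we let the density be \<open>0\<close>; for every nonempty family the
  largest \<open>q\<close> exists, see \<open>independence_density_greatest\<close> below.
\<close>

definition independence_density ::
    "('g, 'n) monoid_scheme \<Rightarrow> 'x topology \<Rightarrow> ('g \<Rightarrow> 'x \<Rightarrow> 'x) \<Rightarrow> 'x set list set \<Rightarrow> real"
  where "independence_density G T \<phi> \<AA> =
    (if \<AA> = {} then 0 else GREATEST q. has_independence_density G T \<phi> \<AA> q)"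

lemma independence_density_greatest:
  assumes G: "carrier G \<noteq> {}" and "\<AA> \<noteq> {}"
  shows "has_independence_density G T \<phi> \<AA> (independence_density G T \<phi> \<AA>)"
    and "has_independence_density G T \<phi> \<AA> q \<Longrightarrow> q \<le> independence_density G T \<phi> \<AA>"
proof -
  let ?P = "has_independence_density G T \<phi> \<AA>"
  let ?Q = "{q. ?P q}"
  have zero: "?P 0"
    using \<open>\<AA> \<noteq> {}\<close> unfolding has_independence_density_def independence_set_def by auto
  have le1: "q \<le> 1" if q: "?P q" for q
  proof -
    from G obtain g where "g \<in> carrier G" by auto
    with q obtain J where J: "J \<subseteq> {g}" "q * real (card {g}) \<le> real (card J)"
      unfolding has_independence_density_def by (metis empty_subsetI finite.intros insert_not_empty insert_subset)
    have "card J \<le> 1" using card_mono[OF _ J(1)] by simp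
    with J(2) show ?thesis by simp
  qed
  have bdd: "bdd_above ?Q" unfolding bdd_above_def using le1 by blast
  define S where "S = Sup ?Q"
  have max: "?P S"
    unfolding has_independence_density_def
  proof (intro conjI allI impI)
    show "0 \<le> S" using cSup_upper[OF _ bdd, of 0] zero by (simp add: S_def)
  next
    fix F assume F: "F \<subseteq> carrier G \<and> finite F \<and> F \<noteq> {}"
    define C where "C = {card J | J. J \<subseteq> F \<and> (\<exists>\<A>\<in>\<AA>. independence_set G T \<phi> \<A> J)}"
    have "C \<subseteq> card ` Pow F" by (auto simp: C_def)
    then have finC: "finite C" using F by (auto intro: finite_subset)
    have neC: "C \<noteq> {}"
      using zero F unfolding has_independence_density_def C_def by blast
    have cF: "0 < real (card F)" using F by (simp add: card_gt_0_iff)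
    have "q \<le> real (Max C) / real (card F)" if "?P q" for q
    proof -
      from that F obtain J where "J \<subseteq> F" "q * real (card F) \<le> real (card J)" "card J \<in> C"
        unfolding has_independence_density_def C_def by blast
      moreover from this have "card J \<le> Max C" using finC by simp
      ultimately show ?thesis using cF by (simp add: pos_le_divide_eq)
    qed
    then have "S \<le> real (Max C) / real (card F)"
      unfolding S_def using zero by (intro cSup_least) auto
    then have "S * real (card F) \<le> real (Max C)" using cF by (simp add: pos_le_divide_eq)
    moreover from Max_in[OF finC neC] obtain J where
      "J \<subseteq> F" "Max C = card J" "\<exists>\<A>\<in>\<AA>. independence_set G T \<phi> \<A> J"
      unfolding C_def by blast
    ultimately show "\<exists>J\<subseteq>F. S * real (card F) \<le> real (card J) \<and>
        (\<exists>\<A>\<in>\<AA>. independence_set G T \<phi> \<A> J)" by metis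
  qed
  have upper: "q \<le> S" if "?P q" for q using cSup_upper[OF _ bdd] that by (simp add: S_def)
  have eq: "independence_density G T \<phi> \<AA> = S"
    using Greatest_equality[of ?P, OF max upper] \<open>\<AA> \<noteq> {}\<close> by (simp add: independence_density_def)
  show "?P (independence_density G T \<phi> \<AA>)" using max eq by simp
  show "q \<le> independence_density G T \<phi> \<AA>" if "?P q" using upper that eq by simp
qed

text \<open>Neighborhoods are not required to be open.\<close>

definition orbit_IE_pair ::
    "('g, 'n) monoid_scheme \<Rightarrow> 'x topology \<Rightarrow> ('g \<Rightarrow> 'x \<Rightarrow> 'x) \<Rightarrow> 'x \<Rightarrow> 'x \<Rightarrow> bool"
  where "orbit_IE_pair G T \<phi> x\<^sub>1 x\<^sub>2 \<longleftrightarrow> x\<^sub>1 \<in> topspace T \<and> x\<^sub>2 \<in> topspace T \<and>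
    (\<forall>U\<^sub>1 U\<^sub>2. U\<^sub>1 \<subseteq> topspace T \<and> U\<^sub>2 \<subseteq> topspace T \<and>
       x\<^sub>1 \<in> T interior_of U\<^sub>1 \<and> x\<^sub>2 \<in> T interior_of U\<^sub>2 \<longrightarrow>
       0 < independence_density G T \<phi> {[U\<^sub>1, U\<^sub>2]})"

end

theory Submission
  imports Defs "HOL-Algebra.Left_Coset"
begin

text \<open>
  Let \<open>a\<close> and \<open>b\<close> be the free generators and let \<open>F2\<close> shift the coordinates of the group of sign
  patterns on the disjoint union of \<open>F2 / \<langle>a\<rangle>\<close> and \<open>F2 / \<langle>b\<rangle>\<close>. Every coordinate has an infinite
  stabilizer, so two sets separated by one coordinate have density \<open>0\<close>, which excludes non-diagonal
  orbit IE-pairs. On the other hand, a finite set of \<open>n\<close> elements of \<open>F2\<close> meets at least \<open>n\<close> cosets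
  of \<open>\<langle>a\<rangle>\<close> and \<open>\<langle>b\<rangle>\<close> altogether, so one of the two base coordinates is moved to at least \<open>n / 2\<close>
  places. This makes the family of the two pairs that these coordinates define independent with
  density at least \<open>1 / 2\<close>, and the naive entropy at least \<open>ln 2 / 2\<close>.
\<close>

section \<open>Group actions from homomorphism laws\<close>

text \<open>\<open>group_action\<close> asks for a homomorphism into \<open>BijGroup\<close>, whose
  elements are extensional bijections. Bijectivity comes from the laws: the inverse element acts as
  the inverse map.\<close>

lemma group_actionI:
  assumes G: "group G"
    and ext: "\<And>g. g \<in> carrier G \<Longrightarrow> \<phi> g \<in> extensional E"
    and closed: "\<And>g x. g \<in> carrier G \<Longrightarrow> x \<in> E \<Longrightarrow> \<phi> g x \<in> E"
    and one: "\<And>x. x \<in> E \<Longrightarrow> \<phi> \<one>\<^bsub>G\<^esub> x = x"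
    and mult: "\<And>g h x. g \<in> carrier G \<Longrightarrow> h \<in> carrier G \<Longrightarrow> x \<in> E \<Longrightarrow>
                 \<phi> (g \<otimes>\<^bsub>G\<^esub> h) x = \<phi> g (\<phi> h x)"
  shows "group_action G E \<phi>"
proof -
  interpret group G by fact
  have bij: "\<phi> g \<in> Bij E" if g: "g \<in> carrier G" for g
  proof -
    have "bij_betw (\<phi> g) E E"
    proof (rule bij_betw_byWitness[where f' = "\<phi> (inv\<^bsub>G\<^esub> g)"])
      show "\<forall>x\<in>E. \<phi> (inv\<^bsub>G\<^esub> g) (\<phi> g x) = x" "\<forall>x\<in>E. \<phi> g (\<phi> (inv\<^bsub>G\<^esub> g) x) = x"
        using g one by (simp_all flip: mult)
    qed (use g closed in auto)
    with ext[OF g] show ?thesis by (simp add: Bij_def)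
  qed
  have "\<phi> (g \<otimes>\<^bsub>G\<^esub> h) = compose E (\<phi> g) (\<phi> h)" if "g \<in> carrier G" "h \<in> carrier G" for g h
    by (rule extensionalityI[of _ E]) (use that ext mult in \<open>auto simp: compose_def\<close>)
  then show ?thesis
    unfolding group_action_def group_hom_def group_hom_axioms_def
    using G bij group_BijGroup[of E] by (auto simp: hom_def BijGroup_def)
qed

text \<open>Coordinates have to be indexed by \<open>nat\<close>, so an action on a countable set is
  carried over along an injection and extended by the identity. The added points are fixed by the
  whole group.\<close>

lemma countable_action_on_nat:
  assumes G: "group G" and E: "countable E"
    and closed: "\<And>g x. g \<in> carrier G \<Longrightarrow> x \<in> E \<Longrightarrow> act g x \<in> E"
    and one: "\<And>x. x \<in> E \<Longrightarrow> act \<one>\<^bsub>G\<^esub> x = x"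
    and mult: "\<And>g h x. g \<in> carrier G \<Longrightarrow> h \<in> carrier G \<Longrightarrow> x \<in> E \<Longrightarrow>
                 act (g \<otimes>\<^bsub>G\<^esub> h) x = act g (act h x)"
  obtains \<pi> :: "'g \<Rightarrow> nat \<Rightarrow> nat" and e where
    "group_action G UNIV \<pi>" "inj_on e E"
    "\<And>g x. g \<in> carrier G \<Longrightarrow> x \<in> E \<Longrightarrow> \<pi> g (e x) = e (act g x)"
    "\<And>g n. n \<notin> e ` E \<Longrightarrow> \<pi> g n = n"
proof -
  obtain e :: "'b \<Rightarrow> nat" where e: "inj_on e E"
    using E by (auto simp: countable_def)
  define \<pi> where "\<pi> g n = (if n \<in> e ` E then e (act g (the_inv_into E e n)) else n)" for g n
  have \<pi>_e: "\<pi> g (e x) = e (act g x)" if "x \<in> E" for g x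
    using that e by (simp add: \<pi>_def the_inv_into_f_f)
  have \<pi>_out: "\<pi> g n = n" if "n \<notin> e ` E" for g n
    using that by (simp add: \<pi>_def)
  have "group_action G UNIV \<pi>"
  proof (rule group_actionI[OF G])
    show "\<pi> \<one>\<^bsub>G\<^esub> n = n" for n
      by (cases "n \<in> e ` E") (auto simp: \<pi>_e \<pi>_out one)
    show "\<pi> (g \<otimes>\<^bsub>G\<^esub> h) n = \<pi> g (\<pi> h n)" if "g \<in> carrier G" "h \<in> carrier G" for g h n
      by (cases "n \<in> e ` E") (auto simp: \<pi>_e \<pi>_out mult closed that)
  qed auto
  with e \<pi>_e \<pi>_out show thesis by (intro that)
qed


section \<open>Generalised Bernoulli shifts\<close>

text \<open>A power of the two-element group, written with complex signs so that it is a subgroup of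
  a power of the circle.\<close>

definition sign_group :: "('i \<Rightarrow> complex) monoid"
  where "sign_group =
    \<lparr>carrier = UNIV \<rightarrow> {1, -1}, mult = (\<lambda>x y i. x i * y i), one = (\<lambda>_. 1)\<rparr>"

definition sign_topology :: "('i \<Rightarrow> complex) topology"
  where "sign_topology = product_topology (\<lambda>_. discrete_topology {1, -1}) UNIV"

lemma topspace_sign_topology: "topspace sign_topology = UNIV \<rightarrow> {1, -1}"
  by (simp add: sign_topology_def PiE_UNIV_domain)

lemma carrier_sign_group: "carrier sign_group = UNIV \<rightarrow> {1, -1}"
  by (simp add: sign_group_def)

lemma sign_group_mult: "(x \<otimes>\<^bsub>sign_group\<^esub> y) i = x i * y i"
  by (simp add: sign_group_def)

lemma continuous_map_sign_coordinate:
  "continuous_map sign_topology (discrete_topology {1, -1}) (\<lambda>x. x i)"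
  unfolding sign_topology_def by (rule continuous_map_product_projection) simp

lemma continuous_map_into_sign_topology:
  "continuous_map S sign_topology f \<longleftrightarrow>
     (\<forall>i. continuous_map S (discrete_topology {1, -1}) (\<lambda>x. f x i))"
  unfolding sign_topology_def by (rule continuous_map_componentwise_UNIV)

lemma openin_sign_topology_coordinates:
  "openin sign_topology {x \<in> topspace sign_topology. P (x i)}"
proof -
  have "openin sign_topology {x \<in> topspace sign_topology. x i \<in> {c \<in> {1, -1}. P c}}"
    by (rule openin_continuous_map_preimage[OF continuous_map_sign_coordinate]) auto
  also have "{x \<in> topspace sign_topology. x i \<in> {c \<in> {1, -1}. P c}}
               = {x \<in> topspace sign_topology. P (x i)}"
    by (auto simp: topspace_sign_topology Pi_iff)
  finally show ?thesis .
qed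

lemma comm_group_sign_group: "comm_group sign_group"
proof (rule comm_groupI)
  show "\<exists>y\<in>carrier sign_group. y \<otimes>\<^bsub>sign_group\<^esub> x = \<one>\<^bsub>sign_group\<^esub>"
    if "x \<in> carrier sign_group" for x :: "'i \<Rightarrow> complex"
  proof (rule bexI[OF _ that])
    have "x i * x i = 1" for i
      using that by (auto simp: sign_group_def Pi_iff dest: spec[of _ i])
    then show "x \<otimes>\<^bsub>sign_group\<^esub> x = \<one>\<^bsub>sign_group\<^esub>" by (simp add: sign_group_def)
  qed
  show "x \<otimes>\<^bsub>sign_group\<^esub> y \<in> carrier sign_group"
    if "x \<in> carrier sign_group" "y \<in> carrier sign_group" for x y :: "'i \<Rightarrow> complex"
  proof -
    have "x i * y i \<in> {1, -1}" for i
    proof -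
      have "x i \<in> {1, -1}" "y i \<in> {1, -1}"
        using that by (simp_all add: carrier_sign_group Pi_iff)
      then show ?thesis by auto
    qed
    then show ?thesis by (simp add: sign_group_def Pi_iff)
  qed
qed (simp_all add: sign_group_def mult_ac)

text \<open>Every element squares to the identity; continuity of inversion thus reduces to that of
  the identity map.\<close>

lemma sign_group_inv:
  assumes "x \<in> carrier sign_group"
  shows "inv\<^bsub>sign_group\<^esub> x = x"
proof -
  interpret comm_group sign_group by (rule comm_group_sign_group)
  have "x i * x i = 1" for i
    using assms by (auto simp: sign_group_def Pi_iff dest: spec[of _ i])
  then have "x \<otimes>\<^bsub>sign_group\<^esub> x = \<one>\<^bsub>sign_group\<^esub>" by (simp add: sign_group_def)
  with assms show ?thesis by (intro inv_equality)
qed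

lemma compact_metrizable_abelian_group_sign_group:
  "compact_metrizable_abelian_group sign_group
     (sign_topology :: ('i :: countable \<Rightarrow> complex) topology)"
  unfolding compact_metrizable_abelian_group_def
proof (intro conjI)
  show "comm_group (sign_group :: ('i \<Rightarrow> complex) monoid)"
    by (rule comm_group_sign_group)
  show "topspace sign_topology = carrier (sign_group :: ('i \<Rightarrow> complex) monoid)"
    by (simp add: topspace_sign_topology carrier_sign_group)
  show "compact_space (sign_topology :: ('i \<Rightarrow> complex) topology)"
    by (simp add: sign_topology_def compact_space_product_topology compact_space_discrete_topology)
  \<comment> \<open>Countability of the index type enters here.\<close>
  show "metrizable_space (sign_topology :: ('i \<Rightarrow> complex) topology)"
    by (simp add: sign_topology_def metrizable_space_product_topology)
  have "continuous_map (prod_topology sign_topology sign_topology) (discrete_topology {1, -1})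
          (\<lambda>p. fst p i * snd p i)" for i :: 'i
  proof -
    \<comment> \<open>Each coordinate of the group product factors through a discrete space, on
      which multiplication of signs is continuous for free.\<close>
    have pair: "continuous_map (prod_topology sign_topology sign_topology)
            (discrete_topology ({1, -1} \<times> {1, -1}))
            (\<lambda>p :: ('i \<Rightarrow> complex) \<times> ('i \<Rightarrow> complex). (fst p i, snd p i))"
      unfolding prod_topology_discrete_topology
      by (intro continuous_map_pairedI
            continuous_map_compose[OF continuous_map_fst continuous_map_sign_coordinate, unfolded o_def]
            continuous_map_compose[OF continuous_map_snd continuous_map_sign_coordinate, unfolded o_def])
    have "continuous_map (discrete_topology ({1, -1} \<times> {1, -1}))
        (discrete_topology {1, -1 :: complex}) (\<lambda>(c, d). c * d)"
      by auto
    from continuous_map_compose[OF pair this] show ?thesis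
      by (simp add: o_def)
  qed
  then show "continuous_map (prod_topology sign_topology sign_topology)
      (sign_topology :: ('i \<Rightarrow> complex) topology) (\<lambda>(x, y). x \<otimes>\<^bsub>sign_group\<^esub> y)"
    by (simp add: continuous_map_into_sign_topology sign_group_def case_prod_unfold)
  have "continuous_map sign_topology (sign_topology :: ('i \<Rightarrow> complex) topology) (\<lambda>x. x)"
    by simp
  then show "continuous_map sign_topology (sign_topology :: ('i \<Rightarrow> complex) topology)
      (\<lambda>x. inv\<^bsub>sign_group\<^esub> x)"
    by (rule continuous_map_eq)
       (simp add: sign_group_inv topspace_sign_topology carrier_sign_group)
qed

section \<open>The shift induced by an action on the coordinates\<close>

locale index_action = group_action G "UNIV :: 'i set" \<pi>
  for G (structure) and \<pi> :: "'g \<Rightarrow> 'i \<Rightarrow> 'i"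
begin

sublocale group G
  using group_hom by (rule group_hom.axioms)

text \<open>The inverse makes this a left action, because substitution into the argument reverses
  the order of composition. Restriction to the carrier supplies the extensionality that
  \<open>group_action\<close> demands.\<close>

definition shift :: "'g \<Rightarrow> ('i \<Rightarrow> complex) \<Rightarrow> 'i \<Rightarrow> complex"
  where "shift s = (\<lambda>x \<in> carrier sign_group. \<lambda>i. x (\<pi> (inv s) i))"

lemma shift_apply: "x \<in> carrier sign_group \<Longrightarrow> shift s x i = x (\<pi> (inv s) i)"
  by (simp add: shift_def)

lemma shift_closed: "x \<in> carrier sign_group \<Longrightarrow> shift s x \<in> carrier sign_group"
  by (auto simp: shift_def carrier_sign_group Pi_iff)

lemma inv_fixes_index:
  assumes "s \<in> carrier G" "\<pi> s i = i"
  shows "\<pi> (inv s) i = i"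
  using composition_rule[of i "inv s" s] assms id_eq_one by (metis UNIV_I inv_closed l_inv restrict_apply')

lemma action_shift: "action_by_continuous_automorphisms G sign_group sign_topology shift"
proof -
  have act: "group_action G (carrier sign_group) shift"
  proof (rule group_actionI)
    show "shift \<one> x = x" if "x \<in> carrier sign_group" for x
      using that id_eq_one[symmetric] by (auto simp: shift_apply)
    show "shift (g \<otimes> h) x = shift g (shift h x)"
      if "g \<in> carrier G" "h \<in> carrier G" "x \<in> carrier sign_group" for g h x
      using that by (auto simp: shift_apply shift_closed inv_mult_group composition_rule)
    show "shift g \<in> extensional (carrier sign_group)" for g
      by (simp add: shift_def)
  qed (simp_all add: shift_closed is_group)
  moreover have "shift s \<in> auto sign_group" if "s \<in> carrier G" for s
  proof -
    interpret X: comm_group "sign_group :: ('i \<Rightarrow> complex) monoid"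
      by (rule comm_group_sign_group)
    have "shift s (x \<otimes>\<^bsub>sign_group\<^esub> y) = shift s x \<otimes>\<^bsub>sign_group\<^esub> shift s y"
      if "x \<in> carrier sign_group" "y \<in> carrier sign_group" for x y
    proof
      show "shift s (x \<otimes>\<^bsub>sign_group\<^esub> y) i = (shift s x \<otimes>\<^bsub>sign_group\<^esub> shift s y) i" for i
        using that shift_apply[OF X.m_closed[OF that]] by (simp add: shift_apply sign_group_mult)
    qed
    then show ?thesis
      using group_action.bij_prop0[OF act that] by (simp add: auto_def hom_def shift_closed)
  qed
  moreover have "continuous_map sign_topology sign_topology (shift s)" for s
    unfolding continuous_map_into_sign_topology
  proof
    \<comment> \<open>A coordinate of \<open>shift s x\<close> is itself a coordinate of
      \<open>x\<close>.\<close>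
    show "continuous_map sign_topology (discrete_topology {1, -1}) (\<lambda>x. shift s x i)" for i
      by (rule continuous_map_eq[OF continuous_map_sign_coordinate[of "\<pi> (inv s) i"]])
         (simp add: shift_apply topspace_sign_topology carrier_sign_group)
  qed
  ultimately show ?thesis by (simp add: action_by_continuous_automorphisms_def)
qed

text \<open>
  If \<open>s\<close> fixes \<open>i\<close>, then \<open>shift s\<close> does not change the coordinate \<open>i\<close>, so an independence set for two
  sets separated by this coordinate has at most one element in common with the stabilizer of \<open>i\<close>.
\<close>

lemma density_zero_if_infinite_stabilizer:
  assumes stab: "infinite {s \<in> carrier G. \<pi> s i = i}"
    and A: "\<And>x. x \<in> A \<Longrightarrow> x i = c" and B: "\<And>x. x \<in> B \<Longrightarrow> x i = d" and "c \<noteq> d"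
  shows "\<not> 0 < independence_density G sign_topology shift {[A, B]}"
proof
  define q where "q = independence_density G sign_topology shift {[A, B]}"
  assume "0 < independence_density G sign_topology shift {[A, B]}"
  then have q: "0 < q" by (simp add: q_def)
  have "has_independence_density G sign_topology shift {[A, B]} q"
    unfolding q_def by (rule independence_density_greatest) auto
  then have hid: "\<exists>J \<subseteq> F. q * real (card F) \<le> real (card J) \<and>
      independence_set G sign_topology shift [A, B] J"
    if "F \<subseteq> carrier G" "finite F" "F \<noteq> {}" for F
    using that by (auto simp: has_independence_density_def)
  \<comment> \<open>More than \<open>1 / q\<close> elements of the stabilizer force an independence
    set with at least two elements.\<close>
  obtain m :: nat where m: "real m * q > 1" using reals_Archimedean3[OF q] by blast
  obtain F where F: "finite F" "card F = m" "F \<subseteq> {s \<in> carrier G. \<pi> s i = i}"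
    using infinite_arbitrarily_large[OF stab] by blast
  have "F \<noteq> {}" using F m by auto
  with hid[of F] F obtain J where J: "J \<subseteq> F" "q * real m \<le> real (card J)"
      and ind: "independence_set G sign_topology shift [A, B] J" by auto
  have unchanged: "shift s x i = x i" if "s \<in> J" "x \<in> carrier sign_group" for s x
    using that J F inv_fixes_index[of s i] by (auto simp: shift_apply)
  have "card J \<le> 1"
  proof (rule ccontr)
    assume "\<not> card J \<le> 1"
    then obtain s t where st: "s \<in> J" "t \<in> J" "s \<noteq> t"
      by (metis card_le_Suc0_iff_eq One_nat_def F(1) J(1) finite_subset)
    \<comment> \<open>Sending \<open>s\<close> to \<open>A\<close> and \<open>t\<close> to
      \<open>B\<close> asks one point to have both values \<open>c\<close> and \<open>d\<close> at
      the coordinate \<open>i\<close>.\<close>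
    define \<omega> where "\<omega> u = (if u = s then 0 else 1 :: nat)" for u
    have "(\<Inter>u\<in>{s, t}. translate sign_topology shift u ([A, B] ! \<omega> u)) \<noteq> {}"
      using ind st unfolding independence_set_def
      by (elim conjE allE[of _ "{s, t}"] allE[of _ \<omega>]) (auto simp: \<omega>_def)
    then obtain x where "x \<in> carrier sign_group" "shift s x \<in> A" "shift t x \<in> B"
      using st by (auto simp: translate_def \<omega>_def topspace_sign_topology carrier_sign_group)
    with unchanged[OF st(1)] unchanged[OF st(2)] A B \<open>c \<noteq> d\<close> show False by metis
  qed
  with J m show False by (simp add: mult.commute)
qed

text \<open>Distinct points differ in some coordinate; prescribing that coordinate gives open
  neighborhoods whose density vanishes.\<close>

lemma no_orbit_IE_pair_if_infinite_stabilizers: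
  assumes stab: "\<And>i. infinite {s \<in> carrier G. \<pi> s i = i}" and "x \<noteq> y"
  shows "\<not> orbit_IE_pair G sign_topology shift x y"
proof
  assume IE: "orbit_IE_pair G sign_topology shift x y"
  obtain i where i: "x i \<noteq> y i" using \<open>x \<noteq> y\<close> by auto
  define U where "U z = {w \<in> topspace sign_topology. w i = z i}" for z :: "'i \<Rightarrow> complex"
  have "openin sign_topology (U z)" for z
    unfolding U_def by (rule openin_sign_topology_coordinates)
  then have "0 < independence_density G sign_topology shift {[U x, U y]}"
    using IE by (auto simp: orbit_IE_pair_def interior_of_openin U_def)
  moreover have "\<not> 0 < independence_density G sign_topology shift {[U x, U y]}"
    by (rule density_zero_if_infinite_stabilizer[OF stab _ _ i]) (auto simp: U_def)
  ultimately show False by simp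
qed

section \<open>Positive density for the family of coordinate pairs\<close>

definition sign_pair :: "'i \<Rightarrow> ('i \<Rightarrow> complex) set list"
  where "sign_pair i =
    [{x \<in> topspace sign_topology. x i = 1}, {x \<in> topspace sign_topology. x i = -1}]"

lemma closed_disjoint_sign_pair:
  "sign_pair i \<in> set_tuples sign_topology 2"
  "pairwise_disjoint_tuple (sign_pair i)" "closed_tuple sign_topology (sign_pair i)"
proof -
  have "closedin sign_topology {x \<in> topspace sign_topology. x i = c}" for c
  proof -
    have "topspace sign_topology - {x \<in> topspace sign_topology. x i = c}
            = {x \<in> topspace sign_topology. x i \<noteq> c}" by auto
    then show ?thesis
      using openin_sign_topology_coordinates[of "\<lambda>z. z \<noteq> c" i] by (simp add: closedin_def)
  qed
  then show "closed_tuple sign_topology (sign_pair i)"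
    by (simp add: closed_tuple_def sign_pair_def)
  show "sign_pair i \<in> set_tuples sign_topology 2"
    by (auto simp: set_tuples_def sign_pair_def)
  show "pairwise_disjoint_tuple (sign_pair i)"
    by (auto simp: pairwise_disjoint_tuple_def sign_pair_def less_Suc_eq numeral_2_eq_2)
qed

text \<open>Membership of \<open>x\<close> in the translate by \<open>s\<close> concerns only its
  coordinate \<open>\<pi> (inv s) i\<close>. By injectivity these coordinates are distinct for
  distinct \<open>s\<close> in \<open>J\<close>, so their signs can be prescribed freely.\<close>

lemma independence_set_sign_pair:
  assumes "J \<subseteq> carrier G" "inj_on (\<lambda>s. \<pi> (inv s) i) J"
  shows "independence_set G sign_topology shift (sign_pair i) J"
  unfolding independence_set_def
proof (intro conjI allI impI)
  fix F \<omega>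
  assume "F \<subseteq> J \<and> finite F \<and> F \<noteq> {} \<and> \<omega> \<in> F \<rightarrow> {..<length (sign_pair i)}"
  then have F: "F \<subseteq> J" and \<omega>: "\<And>s. s \<in> F \<Longrightarrow> \<omega> s < 2"
    by (auto simp: sign_pair_def numeral_2_eq_2)
  \<comment> \<open>List position 1 is the set with sign -1; coordinates that \<open>F\<close> does
    not reach get the default value 1.\<close>
  define x :: "'i \<Rightarrow> complex"
    where "x j = (if \<exists>s\<in>F. \<pi> (inv s) i = j \<and> \<omega> s = 1 then -1 else 1)" for j
  have x: "x \<in> carrier sign_group" by (auto simp: x_def carrier_sign_group)
  have "x \<in> translate sign_topology shift s (sign_pair i ! \<omega> s)" if s: "s \<in> F" for s
  proof -
    have "x (\<pi> (inv s) i) = (if \<omega> s = 1 then -1 else 1)"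
      using s F assms(2) by (auto simp: x_def dest: inj_onD)
    moreover have "\<omega> s = 0 \<or> \<omega> s = 1" using \<omega>[OF s] by auto
    moreover have "shift s x \<in> topspace sign_topology" "x \<in> topspace sign_topology"
      using shift_closed[OF x] x by (simp_all add: topspace_sign_topology carrier_sign_group)
    ultimately show ?thesis
      by (auto simp: translate_def sign_pair_def shift_apply[OF x])
  qed
  then show "(\<Inter>s\<in>F. translate sign_topology shift s (sign_pair i ! \<omega> s)) \<noteq> {}" by blast
qed (use assms in auto)

text \<open>One of the two images has at least half the size of \<open>F\<close>; \<open>J\<close>
  selects one element from each fibre over it.\<close>

lemma large_injective_subset:
  assumes "finite F"
    and "card F \<le> card ((\<lambda>s. \<pi> (inv s) p) ` F) + card ((\<lambda>s. \<pi> (inv s) q) ` F)"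
  obtains J i where "i \<in> {p, q}" "J \<subseteq> F" "inj_on (\<lambda>s. \<pi> (inv s) i) J" "card F \<le> 2 * card J"
proof -
  have "card F \<le> 2 * card ((\<lambda>s. \<pi> (inv s) p) ` F) \<or> card F \<le> 2 * card ((\<lambda>s. \<pi> (inv s) q) ` F)"
    using assms(2) by linarith
  then obtain i where i: "i \<in> {p, q}" "card F \<le> 2 * card ((\<lambda>s. \<pi> (inv s) i) ` F)" by blast
  obtain J where "J \<subseteq> F" "inj_on (\<lambda>s. \<pi> (inv s) i) J"
      "(\<lambda>s. \<pi> (inv s) i) ` F = (\<lambda>s. \<pi> (inv s) i) ` J"
    using subset_image_inj[of "(\<lambda>s. \<pi> (inv s) i) ` F" "\<lambda>s. \<pi> (inv s) i" F] by blast
  with i show thesis by (intro that[of i J]) (auto simp: card_image)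
qed

text \<open>Which of the two pairs is independent on a large \<open>J\<close> depends on
  \<open>F\<close>; hence the bound \<open>1/2\<close> is for the family and not for a single
  pair.\<close>

lemma density_sign_pairs_pos:
  assumes "\<And>F. F \<subseteq> carrier G \<Longrightarrow> finite F \<Longrightarrow>
      card F \<le> card ((\<lambda>s. \<pi> (inv s) p) ` F) + card ((\<lambda>s. \<pi> (inv s) q) ` F)"
  shows "0 < independence_density G sign_topology shift {sign_pair p, sign_pair q}"
proof -
  have "has_independence_density G sign_topology shift {sign_pair p, sign_pair q} (1/2)"
    unfolding has_independence_density_def
  proof (intro conjI allI impI)
    fix F assume F: "F \<subseteq> carrier G \<and> finite F \<and> F \<noteq> {}"
    then obtain J i where
      "i \<in> {p, q}" "J \<subseteq> F" "inj_on (\<lambda>s. \<pi> (inv s) i) J" "card F \<le> 2 * card J"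
      by (elim conjE) (rule large_injective_subset[OF _ assms])
    with F show "\<exists>J\<subseteq>F. 1/2 * real (card F) \<le> real (card J) \<and>
        (\<exists>\<A>\<in>{sign_pair p, sign_pair q}. independence_set G sign_topology shift \<A> J)"
      by (intro exI[of _ J] conjI bexI[of _ "sign_pair i"] independence_set_sign_pair) auto
  qed simp
  then have "1/2 \<le> independence_density G sign_topology shift {sign_pair p, sign_pair q}"
    by (rule independence_density_greatest(2)[rotated 2]) auto
  then show ?thesis by simp
qed

section \<open>Naive entropy of the cover by coordinate cells\<close>

text \<open>Both coordinates are recorded at once, as a single cover has to serve every
  \<open>F\<close>, whichever of \<open>p\<close> and \<open>q\<close> has the larger image.\<close>

definition sign_cover :: "'i \<Rightarrow> 'i \<Rightarrow> ('i \<Rightarrow> complex) set set"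
  where "sign_cover p q =
    (\<lambda>(c, d). {x \<in> topspace sign_topology. x p = c \<and> x q = d}) ` ({1, -1} \<times> {1, -1})"

lemma finite_open_cover_sign_cover: "finite_open_cover sign_topology (sign_cover p q)"
proof -
  have "openin sign_topology {x \<in> topspace sign_topology. x p = c \<and> x q = d}" for c d
  proof -
    have "{x \<in> topspace sign_topology. x p = c \<and> x q = d} =
      {x \<in> topspace sign_topology. x p = c} \<inter> {x \<in> topspace sign_topology. x q = d}" by auto
    then show ?thesis
      using openin_Int[OF openin_sign_topology_coordinates[of "\<lambda>z. z = c" p]
        openin_sign_topology_coordinates[of "\<lambda>z. z = d" q]] by simp
  qed
  moreover have "\<Union>(sign_cover p q) = topspace sign_topology"
  proof (rule antisym)
    show "topspace sign_topology \<subseteq> \<Union>(sign_cover p q)"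
    proof
      fix x :: "'i \<Rightarrow> complex" assume x: "x \<in> topspace sign_topology"
      then have "(x p, x q) \<in> {1, -1} \<times> {1, -1}"
        unfolding topspace_sign_topology by (blast dest: funcset_mem)
      then show "x \<in> \<Union>(sign_cover p q)"
        unfolding sign_cover_def by (rule UnionI[OF imageI]) (simp add: x)
    qed
  qed (auto simp: sign_cover_def)
  ultimately show ?thesis by (auto simp: finite_open_cover_def sign_cover_def)
qed

lemma sign_cover_power_covers:
  "\<Union>(cover_power sign_topology shift (sign_cover p q) F) \<supseteq> topspace sign_topology"
proof
  fix x :: "'i \<Rightarrow> complex" assume x: "x \<in> topspace sign_topology"
  have "\<exists>V \<in> translate sign_topology shift s ` sign_cover p q. x \<in> V" for s
  proof -
    have "shift s x \<in> \<Union>(sign_cover p q)"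
      using finite_open_cover_sign_cover[of p q] shift_closed[of x s] x
      by (simp add: finite_open_cover_def topspace_sign_topology carrier_sign_group)
    with x show ?thesis by (auto simp: translate_def)
  qed
  then obtain c where c: "\<And>s. c s \<in> translate sign_topology shift s ` sign_cover p q" "\<And>s. x \<in> c s"
    by metis
  then have "(\<Inter>s\<in>F. c s) \<in> cover_power sign_topology shift (sign_cover p q) F"
    unfolding cover_power_def cover_join_def by blast
  with c(2) show "x \<in> \<Union>(cover_power sign_topology shift (sign_cover p q) F)" by blast
qed

text \<open>Each cell of \<open>sign_cover\<close> fixes both coordinates. Points whose shifts
  disagree at \<open>p\<close> or \<open>q\<close> therefore need different members of a
  subcover.\<close>

lemma cover_power_sign_cover_same:
  assumes "V \<in> cover_power sign_topology shift (sign_cover p q) F" "x \<in> V" "y \<in> V" "s \<in> F"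
  shows "shift s x p = shift s y p" "shift s x q = shift s y q"
proof -
  from assms(1,4) obtain c where c: "V = (\<Inter>s\<in>F. c s)" "c s \<in> translate sign_topology shift s ` sign_cover p q"
    unfolding cover_power_def cover_join_def by blast
  from c(2) obtain U where U: "U \<in> sign_cover p q" "c s = translate sign_topology shift s U" by blast
  have "x \<in> c s" "y \<in> c s" using assms(2-4) c(1) by auto
  then have "shift s x \<in> U" "shift s y \<in> U" using U(2) by (auto simp: translate_def)
  with U(1) show "shift s x p = shift s y p" "shift s x q = shift s y q"
    by (auto simp: sign_cover_def)
qed

text \<open>A member of the join depends only on the restriction to \<open>F\<close> of its choice
  function, and there are finitely many such restrictions.\<close>

lemma finite_cover_power_sign_cover:
  assumes "finite F"
  shows "finite (cover_power sign_topology shift (sign_cover p q) F)"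
proof -
  let ?W = "\<lambda>s. translate sign_topology shift s ` sign_cover p q"
  have "cover_power sign_topology shift (sign_cover p q) F \<subseteq> (\<lambda>c. \<Inter>s\<in>F. c s) ` PiE F ?W"
  proof
    fix V assume "V \<in> cover_power sign_topology shift (sign_cover p q) F"
    then obtain c where "V = (\<Inter>s\<in>F. c s)" "\<forall>s\<in>F. c s \<in> ?W s"
      unfolding cover_power_def cover_join_def by blast
    then show "V \<in> (\<lambda>c. \<Inter>s\<in>F. c s) ` PiE F ?W"
      by (intro image_eqI[of _ _ "restrict c F"]) auto
  qed
  moreover have "finite (sign_cover p q)" by (simp add: sign_cover_def)
  then have "finite (PiE F ?W)" using assms by (intro finite_PiE) auto
  ultimately show ?thesis by (meson finite_imageI finite_subset)
qed

text \<open>For empty \<open>F\<close> the join would consist of the empty intersection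
  \<open>UNIV\<close>, which is larger than the space; hence the hypothesis.\<close>

lemma Union_cover_power_sign_cover:
  assumes "F \<noteq> {}"
  shows "\<Union>(cover_power sign_topology shift (sign_cover p q) F) = topspace sign_topology"
proof (rule antisym[OF _ sign_cover_power_covers])
  obtain s where s: "s \<in> F" using assms by auto
  show "\<Union>(cover_power sign_topology shift (sign_cover p q) F) \<subseteq> topspace sign_topology"
  proof (rule Union_least)
    fix V assume "V \<in> cover_power sign_topology shift (sign_cover p q) F"
    then obtain c where "V = (\<Inter>s\<in>F. c s)" "c s \<in> translate sign_topology shift s ` sign_cover p q"
      using s unfolding cover_power_def cover_join_def by blast
    with s show "V \<subseteq> topspace sign_topology" by (auto simp: translate_def)
  qed
qed

text \<open>
  The \<open>2 ^ card J\<close> sign patterns on \<open>J\<close> are realised by points of which no two lie in a common member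
  of the cover.
\<close>

lemma min_subcover_sign_cover:
  assumes F: "finite F" "F \<noteq> {}" "F \<subseteq> carrier G" and i: "i \<in> {p, q}"
    and J: "J \<subseteq> F" "inj_on (\<lambda>s. \<pi> (inv s) i) J"
  shows "2 ^ card J \<le> min_subcover sign_topology (cover_power sign_topology shift (sign_cover p q) F)"
proof -
  let ?W = "cover_power sign_topology shift (sign_cover p q) F"
  define x :: "'g set \<Rightarrow> 'i \<Rightarrow> complex"
    where "x S j = (if \<exists>s\<in>S. \<pi> (inv s) i = j then -1 else 1)" for S j
  have x: "x S \<in> topspace sign_topology" for S
    by (auto simp: x_def topspace_sign_topology)
  \<comment> \<open>Injectivity on \<open>J\<close> ensures that no element of \<open>J - S\<close>
    reaches a coordinate where \<open>x S\<close> is -1.\<close>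
  have shift_x: "shift s (x S) i = (if s \<in> S then -1 else 1)" if "S \<subseteq> J" "s \<in> J" for s S
    using that J(2) x[of S]
    by (auto simp: shift_apply topspace_sign_topology carrier_sign_group x_def dest: inj_onD)
  have *: "2 ^ card J \<le> card \<V>"
    if \<V>: "\<V> \<subseteq> ?W" "finite \<V>" "\<Union>\<V> = topspace sign_topology" for \<V>
  proof -
    have "\<exists>V\<in>\<V>. x S \<in> V" for S using x[of S] \<V>(3) by blast
    then obtain v where v: "\<And>S. v S \<in> \<V>" "\<And>S. x S \<in> v S" by metis
    have "inj_on v (Pow J)"
    proof (rule inj_onI)
      fix S S' assume S: "S \<in> Pow J" "S' \<in> Pow J" "v S = v S'"
      have "s \<in> S \<longleftrightarrow> s \<in> S'" if s: "s \<in> J" for s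
      proof -
        have "v S \<in> ?W" "x S \<in> v S" "x S' \<in> v S" "s \<in> F"
          using v[of S] v[of S'] \<V>(1) S(3) J(1) s by auto
        then have "shift s (x S) i = shift s (x S') i"
          using cover_power_sign_cover_same[of "v S" p q F "x S" "x S'" s] i by auto
        then show ?thesis using shift_x s S by (auto split: if_splits)
      qed
      then show "S = S'" using S by auto
    qed
    then have "card (Pow J) \<le> card \<V>"
      using v(1) \<V>(2) by (intro card_inj_on_le[of v]) auto
    then show ?thesis using finite_subset[OF J(1) F(1)] by (simp add: card_Pow)
  qed
  \<comment> \<open>The join itself is a finite subcover, so the \<open>LEAST\<close> in
    \<open>min_subcover\<close> is attained and the bound above applies to a minimal
    subcover.\<close>
  have "\<exists>\<V>. \<V> \<subseteq> ?W \<and> finite \<V> \<and> \<Union>\<V> = topspace sign_topology \<and> card \<V> = card ?W"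
    using finite_cover_power_sign_cover[OF F(1)] Union_cover_power_sign_cover[OF F(2)]
    by (intro exI[of _ ?W]) simp
  then have "\<exists>\<V>. \<V> \<subseteq> ?W \<and> finite \<V> \<and> \<Union>\<V> = topspace sign_topology \<and>
      card \<V> = min_subcover sign_topology ?W"
    unfolding min_subcover_def by (rule LeastI)
  then obtain \<V> where \<V>: "\<V> \<subseteq> ?W" "finite \<V>" "\<Union>\<V> = topspace sign_topology"
      "card \<V> = min_subcover sign_topology ?W" by blast
  from *[OF \<V>(1-3)] \<V>(4) show ?thesis by simp
qed

text \<open>A subcover has at least \<open>2 ^ card J\<close> members and \<open>J\<close> contains
  at least half of \<open>F\<close>, so every \<open>F\<close> contributes at least
  \<open>ln 2 / 2\<close> to the infimum for one fixed cover.\<close>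

lemma naive_entropy_shift_pos:
  assumes "\<And>F. F \<subseteq> carrier G \<Longrightarrow> finite F \<Longrightarrow>
      card F \<le> card ((\<lambda>s. \<pi> (inv s) p) ` F) + card ((\<lambda>s. \<pi> (inv s) q) ` F)"
  shows "0 < naive_entropy G sign_topology shift"
proof -
  have "0 < ereal (ln 2 / 2)" by simp
  also have "\<dots> \<le> naive_entropy_cover G sign_topology shift (sign_cover p q)"
    unfolding naive_entropy_cover_def
  proof (rule INF_greatest)
    fix F assume "F \<in> {F. F \<subseteq> carrier G \<and> finite F \<and> F \<noteq> {}}"
    then have F: "finite F" "F \<noteq> {}" "F \<subseteq> carrier G" by auto
    obtain J i where J:
      "i \<in> {p, q}" "J \<subseteq> F" "inj_on (\<lambda>s. \<pi> (inv s) i) J" "card F \<le> 2 * card J"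
      by (rule large_injective_subset[OF F(1) assms[OF F(3) F(1)]])
    define N where "N = min_subcover sign_topology (cover_power sign_topology shift (sign_cover p q) F)"
    have "2 ^ card J \<le> N" unfolding N_def by (rule min_subcover_sign_cover[OF F J(1-3)])
    then have "real (2 ^ card J) \<le> real N" by (simp only: of_nat_le_iff)
    then have "ln (2 ^ card J) \<le> ln (real N)" by (intro ln_mono) auto
    then have "real (card J) * ln 2 \<le> ln (real N)" by (simp add: ln_realpow)
    have "ln 2 / 2 * real (card F) \<le> ln 2 / 2 * (2 * real (card J))"
      using J(4) by (intro mult_left_mono) auto
    also have "\<dots> \<le> ln (real N)"
      using \<open>real (card J) * ln 2 \<le> ln (real N)\<close> by (simp add: mult.commute)
    finally have "ln 2 / 2 * real (card F) \<le> ln (real N)" .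
    moreover have "0 < real (card F)" using F by (simp add: card_gt_0_iff)
    ultimately show "ereal (ln 2 / 2) \<le> ereal (ln (real N) / real (card F))"
      by (simp only: pos_le_divide_eq ereal_less_eq)
  qed
  also have "\<dots> \<le> naive_entropy G sign_topology shift"
    unfolding naive_entropy_def using finite_open_cover_sign_cover by (intro SUP_upper) auto
  finally show ?thesis .
qed

end


section \<open>Cosets of the cyclic subgroups generated by the free generators\<close>

text \<open>The cyclic subgroup generated by \<open>c\<close>. Describing it by the letters of
  reduced words makes lengths and cancellation visible.\<close>

definition generator_powers :: "'g \<Rightarrow> ('g \<times> bool) list set"
  where "generator_powers c = {w. reduced w \<and> fst ` set w \<subseteq> {c}}"

interpretation FG: group free_group
  by (rule group_free_group)

lemma inv_free_group:
  assumes "reduced w"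
  shows "inv\<^bsub>free_group\<^esub> w = rev (map inv_letter w)"
proof (rule FG.inv_equality)
  show "rev (map inv_letter w) \<otimes>\<^bsub>free_group\<^esub> w = \<one>\<^bsub>free_group\<^esub>"
    using foldr_inverse[of "[]" w] assms by (simp add: free_group_def foldr_cons_letter_Nil)
qed (use assms in \<open>auto simp: free_group_def reduced_inverse\<close>)

lemma set_foldr_cons_letter: "set (foldr cons_letter u v) \<subseteq> set u \<union> set v"
proof (induction u)
  case (Cons l u)
  have "set (cons_letter l w) \<subseteq> insert l (set w)" for w by (cases w) auto
  with Cons show ?case by fastforce
qed simp

text \<open>Cancellation only deletes letters, and inverting a letter keeps its generator.\<close>

lemma subgroup_generator_powers: "subgroup (generator_powers c) free_group"
proof (rule FG.subgroupI)
  show "inv\<^bsub>free_group\<^esub> u \<in> generator_powers c" if "u \<in> generator_powers c" for u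
    using that
    by (auto simp: generator_powers_def inv_free_group reduced_inverse image_subset_iff inv_letter_def)
  show "u \<otimes>\<^bsub>free_group\<^esub> v \<in> generator_powers c"
    if "u \<in> generator_powers c" "v \<in> generator_powers c" for u v
    using that set_foldr_cons_letter[of u v]
    by (auto simp: generator_powers_def free_group_def reduced_foldr image_subset_iff)
  show "generator_powers c \<noteq> {}"
    by (auto simp: generator_powers_def intro: exI[of _ "[]"])
qed (auto simp: generator_powers_def free_group_def)

lemma infinite_generator_powers: "infinite (generator_powers c)"
proof -
  have "reduced (replicate n (c, True))" for n
    by (induction n) (auto simp: reduced_Cons inv_letter_def)
  then have "range (\<lambda>n. replicate n (c, True)) \<subseteq> generator_powers c"
    by (auto simp: generator_powers_def)
  moreover have "inj (\<lambda>n. replicate n (c, True))"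
    by (metis injI length_replicate)
  ultimately show ?thesis by (meson finite_subset range_inj_infinite)
qed

lemma foldr_cons_letter_append: "reduced (u @ v) \<Longrightarrow> foldr cons_letter u v = u @ v"
  by (induction u) (auto simp: reduced_Cons cons_letter_reduced)

text \<open>The last letter of \<open>w\<close> cannot cancel against a power of \<open>c\<close>,
  so \<open>w\<close> is the unique shortest element of its coset.\<close>

lemma length_coset_generator_powers:
  assumes w: "reduced w" "w = [] \<or> fst (last w) \<noteq> c"
    and u: "u \<in> w <#\<^bsub>free_group\<^esub> generator_powers c" "u \<noteq> w"
  shows "length w < length u"
proof -
  obtain v where v: "v \<in> generator_powers c" "u = foldr cons_letter w v"
    using u(1) by (auto simp: l_coset_def free_group_def)
  have "reduced (w @ v)"
  proof (cases "w = [] \<or> v = []")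
    case False
    then have "hd v \<in> set v" by simp
    then have "fst (hd v) = c" using v(1) by (auto simp: generator_powers_def)
    with False w v(1) show ?thesis
      by (auto simp: reduced_def generator_powers_def successively_append_iff inv_letter_def)
  qed (use w v in \<open>auto simp: generator_powers_def\<close>)
  then have "u = w @ v" using v(2) by (simp add: foldr_cons_letter_append)
  with u(2) show ?thesis by auto
qed

text \<open>
  The cosets of the two cyclic subgroups are the vertices, and the elements of the group the edges,
  of the Bass--Serre tree of the free product: a finite forest has at most as many edges as vertices.
  A word of maximal length in \<open>F\<close> is an edge at a leaf, which allows an induction on \<open>F\<close>.
\<close>

lemma card_le_card_cosets:
  fixes F :: "(bool \<times> bool) list set"
  assumes "finite F" "F \<subseteq> carrier F2"
  shows "card F \<le> card ((\<lambda>w. w <#\<^bsub>F2\<^esub> generator_powers True) ` F) +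
                   card ((\<lambda>w. w <#\<^bsub>F2\<^esub> generator_powers False) ` F)"
  using assms
proof (induction "card F" arbitrary: F)
  case (Suc n)
  let ?C = "\<lambda>c w. w <#\<^bsub>F2\<^esub> generator_powers c"
  from Suc have "F \<noteq> {}" by auto
  then have "Max (length ` F) \<in> length ` F" using Suc.prems by simp
  then obtain w where w: "w \<in> F" and "length w = Max (length ` F)" by force
  then have max: "length u \<le> length w" if "u \<in> F" for u using that Suc.prems by simp
  define F' where "F' = F - {w}"
  have F: "F = insert w F'" "w \<notin> F'" "finite F'" using w Suc.prems by (auto simp: F'_def)
  \<comment> \<open>The generator other than that of the last letter of \<open>w\<close>. For empty
    \<open>w\<close> the value of \<open>last w\<close> is unspecified, but then either choice of
    \<open>c\<close> satisfies the condition of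
    \<open>length_coset_generator_powers\<close>.\<close>
  define c where "c = (\<not> fst (last w))"
  have "reduced w" using w Suc.prems by (auto simp: free_group_def)
  \<comment> \<open>Another element of \<open>F\<close> in this coset would be longer than
    \<open>w\<close>, against maximality; so the coset is a leaf, and it disappears together with
    \<open>w\<close>.\<close>
  have "?C c w \<notin> ?C c ` F'"
  proof
    assume "?C c w \<in> ?C c ` F'"
    then obtain u where u: "u \<in> F'" "?C c w = ?C c u" by blast
    have "u \<in> ?C c u"
      using u(1) Suc.prems(2) by (intro FG.lcos_self subgroup_generator_powers) (auto simp: F'_def)
    then have "length w < length u"
      using u \<open>reduced w\<close> F(2) by (intro length_coset_generator_powers[of w c u]) (auto simp: c_def)
    with max[of u] u(1) show False by (simp add: F'_def)
  qed
  then have c: "card (?C c ` F) = Suc (card (?C c ` F'))" using F by simp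
  have nc: "card (?C (\<not> c) ` F') \<le> card (?C (\<not> c) ` F)" using F by (intro card_mono) auto
  have "card F' \<le> card (?C True ` F') + card (?C False ` F')"
    using Suc F by (intro Suc.hyps(1)) auto
  with c nc F show ?case by (cases c) auto
qed simp

text \<open>The stabilizer of \<open>g <# H\<close> contains the conjugate of \<open>H\<close> by
  \<open>g\<close>, and conjugation is injective.\<close>

lemma (in group) infinite_coset_stabilizer:
  assumes "subgroup H G" "infinite H" "g \<in> carrier G"
  shows "infinite {s \<in> carrier G. s <# (g <# H) = g <# H}"
proof -
  have H: "H \<subseteq> carrier G" using assms(1) by (rule subgroup.subset)
  have "(\<lambda>h. g \<otimes> h \<otimes> inv g) ` H \<subseteq> {s \<in> carrier G. s <# (g <# H) = g <# H}"
  proof clarify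
    fix h assume h: "h \<in> H"
    then have "h \<in> carrier G" using H by auto
    have "(g \<otimes> h \<otimes> inv g) <# (g <# H) = (g \<otimes> h \<otimes> inv g \<otimes> g) <# H"
      using H assms(3) \<open>h \<in> carrier G\<close> by (simp add: lcos_m_assoc)
    also have "\<dots> = (g \<otimes> h) <# H"
      using assms(3) \<open>h \<in> carrier G\<close> by (simp add: m_assoc)
    also have "\<dots> = g <# (h <# H)"
      using H assms(3) \<open>h \<in> carrier G\<close> by (simp add: lcos_m_assoc)
    also have "h <# H = H"
      using h assms(1) by (metis subgroup_mult_id coset_join3 \<open>h \<in> carrier G\<close>)
    finally show "g \<otimes> h \<otimes> inv g \<in> carrier G \<and> (g \<otimes> h \<otimes> inv g) <# (g <# H) = g <# H"
      using assms(3) \<open>h \<in> carrier G\<close> by simp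
  qed
  moreover have "inj_on (\<lambda>h. g \<otimes> h \<otimes> inv g) H"
    using H assms(3) by (intro inj_onI) (auto simp: subset_iff)
  ultimately show ?thesis
    using assms(2) by (meson finite_imageD finite_subset)
qed

section \<open>The free group acting on the cosets, with the cosets numbered by naturals\<close>

theorem proposition5p2:
  shows "\<exists>(X :: (nat \<Rightarrow> complex) monoid) (T :: (nat \<Rightarrow> complex) topology)
            (\<phi> :: (bool \<times> bool) list \<Rightarrow> (nat \<Rightarrow> complex) \<Rightarrow> (nat \<Rightarrow> complex)).
     compact_metrizable_abelian_group X T \<and>
     action_by_continuous_automorphisms F2 X T \<phi> \<and>
     0 < naive_entropy F2 T \<phi> \<and>
     \<not> (\<exists>x\<^sub>1 x\<^sub>2. x\<^sub>1 \<noteq> x\<^sub>2 \<and> orbit_IE_pair F2 T \<phi> x\<^sub>1 x\<^sub>2) \<and>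
     (\<exists>\<AA>. finite \<AA> \<and> \<AA> \<subseteq> set_tuples T 2 \<and>
        (\<forall>\<A> \<in> \<AA>. pairwise_disjoint_tuple \<A> \<and> closed_tuple T \<A>) \<and>
        0 < independence_density F2 T \<phi> \<AA> \<and>
        \<not> (\<exists>\<A> \<in> \<AA>. 0 < independence_density F2 T \<phi> {\<A>}))"
proof -
  let ?H = "generator_powers :: bool \<Rightarrow> (bool \<times> bool) list set"
  \<comment> \<open>The vertices of the Bass-Serre tree, as subsets of \<open>F2\<close> on which
    \<open><#\<close> acts by left translation.\<close>
  define E where "E = (\<lambda>(c, w). w <#\<^bsub>F2\<^esub> ?H c) ` (UNIV \<times> carrier F2)"
  have H: "?H c \<subseteq> carrier F2" for c
    using subgroup_generator_powers by (rule subgroup.subset)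
  have E: "\<exists>c. \<exists>w\<in>carrier F2. A = w <#\<^bsub>F2\<^esub> ?H c" if "A \<in> E" for A
    using that by (auto simp: E_def)
  have coset_E: "w <#\<^bsub>F2\<^esub> ?H c \<in> E" if "w \<in> carrier F2" for c w
    unfolding E_def using that by (intro image_eqI[of _ _ "(c, w)"]) auto
  have E_sub: "A \<subseteq> carrier F2" if "A \<in> E" for A
    using E[OF that] FG.l_coset_subset_G[OF H] by auto
  obtain \<pi> :: "(bool \<times> bool) list \<Rightarrow> nat \<Rightarrow> nat" and e where
    act: "group_action F2 UNIV \<pi>" and e: "inj_on e E"
    and \<pi>_e: "\<And>g A. g \<in> carrier F2 \<Longrightarrow> A \<in> E \<Longrightarrow> \<pi> g (e A) = e (g <#\<^bsub>F2\<^esub> A)"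
    and \<pi>_out: "\<And>g n. n \<notin> e ` E \<Longrightarrow> \<pi> g n = n"
  proof (rule countable_action_on_nat[OF group_free_group, of E "\<lambda>g A. g <#\<^bsub>F2\<^esub> A"])
    show "countable E" unfolding E_def by (intro countable_image countableI_type)
    show "g <#\<^bsub>F2\<^esub> A \<in> E" if "g \<in> carrier F2" "A \<in> E" for g A
      using E[OF that(2)] that(1) H by (auto simp: FG.lcos_m_assoc coset_E)
    show "\<one>\<^bsub>F2\<^esub> <#\<^bsub>F2\<^esub> A = A" if "A \<in> E" for A
      by (rule FG.lcos_mult_one[OF E_sub[OF that]])
    show "(g \<otimes>\<^bsub>F2\<^esub> h) <#\<^bsub>F2\<^esub> A = g <#\<^bsub>F2\<^esub> (h <#\<^bsub>F2\<^esub> A)"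
      if "g \<in> carrier F2" "h \<in> carrier F2" "A \<in> E" for g h A
      using FG.lcos_m_assoc[OF E_sub] that by simp
  qed (rule that, assumption+)
  interpret index_action F2 \<pi>
    using act by (simp add: index_action_def)
  have stab: "infinite {s \<in> carrier F2. \<pi> s n = n}" for n
  proof (cases "n \<in> e ` E")
    case True
    then obtain A where A: "A \<in> E" "n = e A" by blast
    then obtain c w where w: "w \<in> carrier F2" "A = w <#\<^bsub>F2\<^esub> ?H c" using E by blast
    have "{s \<in> carrier F2. s <#\<^bsub>F2\<^esub> A = A} \<subseteq> {s \<in> carrier F2. \<pi> s n = n}"
      using A \<pi>_e by auto
    then show ?thesis
      using FG.infinite_coset_stabilizer[OF subgroup_generator_powers infinite_generator_powers w(1)]
        w(2) finite_subset by blast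
  next
    case False
    \<comment> \<open>Indices outside the image of \<open>e\<close> are fixed by all of
      \<open>F2\<close>.\<close>
    have "infinite (carrier F2)"
      using finite_subset[OF H[of True]] infinite_generator_powers[of True] by blast
    with False show ?thesis by (simp add: \<pi>_out)
  qed
  \<comment> \<open>The base coordinates are the two cyclic subgroups themselves, viewed as
    cosets.\<close>
  define i where "i c = e (?H c)" for c
  have card_orbits: "card F \<le> card ((\<lambda>s. \<pi> (inv\<^bsub>F2\<^esub> s) (i True)) ` F) +
                             card ((\<lambda>s. \<pi> (inv\<^bsub>F2\<^esub> s) (i False)) ` F)"
    if F: "F \<subseteq> carrier F2" "finite F" for F
  proof -
    \<comment> \<open>The shift reads coordinates at inverses, while the coset count concerns the
      elements themselves; inversion preserves cardinality.\<close>
    define F' where "F' = m_inv F2 ` F"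
    have F': "finite F'" "F' \<subseteq> carrier F2" using F by (auto simp: F'_def)
    have "card ((\<lambda>s. \<pi> (inv\<^bsub>F2\<^esub> s) (i c)) ` F) = card ((\<lambda>w. w <#\<^bsub>F2\<^esub> ?H c) ` F')" for c
    proof -
      have HE: "?H c \<in> E"
        using coset_E[of "\<one>\<^bsub>F2\<^esub>" c] FG.lcos_mult_one[OF H] by simp
      have "(\<lambda>s. \<pi> (inv\<^bsub>F2\<^esub> s) (i c)) ` F = e ` (\<lambda>w. w <#\<^bsub>F2\<^esub> ?H c) ` F'"
        unfolding F'_def image_image
        by (rule image_cong[OF refl]) (use F HE in \<open>auto simp: i_def \<pi>_e\<close>)
      moreover have "(\<lambda>w. w <#\<^bsub>F2\<^esub> ?H c) ` F' \<subseteq> E" using F' coset_E by auto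
      ultimately show ?thesis using card_image[OF inj_on_subset[OF e]] by simp
    qed
    moreover have "card F' = card F"
      unfolding F'_def using F(1) FG.inv_inj by (intro card_image) (rule inj_on_subset)
    ultimately show ?thesis using card_le_card_cosets[OF F'] by simp
  qed
  have "\<not> 0 < independence_density F2 sign_topology shift {sign_pair n}" for n
    unfolding sign_pair_def
    by (rule density_zero_if_infinite_stabilizer[OF stab, where c = 1 and d = "-1"]) auto
  then have "\<exists>\<AA>. finite \<AA> \<and> \<AA> \<subseteq> set_tuples sign_topology 2 \<and>
      (\<forall>\<A> \<in> \<AA>. pairwise_disjoint_tuple \<A> \<and> closed_tuple sign_topology \<A>) \<and>
      0 < independence_density F2 sign_topology shift \<AA> \<and>
      \<not> (\<exists>\<A> \<in> \<AA>. 0 < independence_density F2 sign_topology shift {\<A>})"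
    using density_sign_pairs_pos[OF card_orbits] closed_disjoint_sign_pair
    by (intro exI[of _ "{sign_pair (i True), sign_pair (i False)}"]) simp
  moreover have "\<not> (\<exists>x\<^sub>1 x\<^sub>2. x\<^sub>1 \<noteq> x\<^sub>2 \<and> orbit_IE_pair F2 sign_topology shift x\<^sub>1 x\<^sub>2)"
    using no_orbit_IE_pair_if_infinite_stabilizers[OF stab] by blast
  ultimately show ?thesis
    using compact_metrizable_abelian_group_sign_group action_shift
      naive_entropy_shift_pos[OF card_orbits]
    by (intro exI[of _ sign_group] exI[of _ sign_topology] exI[of _ shift] conjI)
qed

end
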